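(* Let $\Gamma\subseteq \mathrm{PSL}(2,\mathbb{R})$ be a Fuchsian group of the first kind with $\mathbf{c}>0$ inequivalent cusps, and let $\phi(s)$ be its automorphic scattering determinant. Write, for $\Re(s)>1$, $$\phi(s)=\pi^{\mathbf{c}/2}\left(\frac{\Gamma(s-\tfrac12)}{\Gamma(s)}\right)^{\mathbf{c}}\sum_{n=1}^{\infty}\frac{d(n)}{g_n^{2s}},$$ where $0<g_1<g_2<\cdots$, $d(n)\in\mathbb{R}$ and $d(1)\neq 0$. Let $N$ and $P$ denote the number of zeros and poles, respectively, of $\phi(s)$ in $[1/2,\infty)$, counted with multiplicities. Then $$\phi(1/2)=(-1)^{N+P}\,\mathrm{sgn}(d(1)),$$ where $\mathrm{sgn}$ denotes the sign of a nonzero real number.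
   Context: $\Gamma$ acts on the upper half-plane $\mathbb{H}$ and $M=\Gamma\backslash\mathbb{H}$ is a finite-volume non-compact hyperbolic orbifold (elliptic fixed points allowed). The automorphic scattering determinant $\phi(s)$ is the determinant of the $\mathbf{c}\times\mathbf{c}$ hyperbolic scattering matrix $\Phi(s)$, whose entries are the coefficients of $y^{1-s}$ in the constant terms of the Fourier expansions, at the various cusps, of the non-holomorphic parabolic Eisenstein series of $M$. It is meromorphic in $\mathbb{C}$, of order at most two, holomorphic in $\Re(s)>1/2$ except for finitely many poles (lying in $(1/2,1]$), satisfies $\phi(s)\phi(1-s)=1$, and admits for $\Re(s)>1$ the absolutely convergent representation displayed in the claim. *)

theory Defs
  imports "HOL-Complex_Analysis.Complex_Analysis" "HOL-Algebra.Coset"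
begin

unbundle no fps_syntax

section \<open>The group PSL(2,R) and its actions\<close>

definition SL2R :: "(real^2^2) monoid" where
  "SL2R = \<lparr>carrier = {A. det A = 1}, mult = (\<lambda>A B. A ** B), one = mat 1\<rparr>"

definition PSL2R :: "(real^2^2) set monoid" where
  "PSL2R = SL2R Mod {mat 1, - mat 1}"

text \<open>
  Elements of \<^const>\<open>PSL2R\<close> are the cosets \<open>{A, -A}\<close>. The preimage in SL(2,R) of
  a subgroup \<open>\<Gamma>\<close> of PSL(2,R) is therefore \<open>\<Union>\<Gamma>\<close>; notions that are invariant
  under \<open>A \<mapsto> -A\<close> are stated through this preimage.
\<close>

definition upper_half_plane :: "complex set" where
  "upper_half_plane = {z. Im z > 0}"

definition moebius :: "real^2^2 \<Rightarrow> complex \<Rightarrow> complex" where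
  "moebius A z = (of_real (A$1$1) * z + of_real (A$1$2)) / (of_real (A$2$1) * z + of_real (A$2$2))"

datatype boundary_point = Finite_Point real | Infinity_Point

fun moebius_boundary :: "real^2^2 \<Rightarrow> boundary_point \<Rightarrow> boundary_point" where
  "moebius_boundary A (Finite_Point x) =
     (if A$2$1 * x + A$2$2 = 0 then Infinity_Point
      else Finite_Point ((A$1$1 * x + A$1$2) / (A$2$1 * x + A$2$2)))"
| "moebius_boundary A Infinity_Point =
     (if A$2$1 = 0 then Infinity_Point else Finite_Point (A$1$1 / A$2$1))"


section \<open>Fuchsian groups of the first kind and of finite covolume\<close>

text \<open>
  The projection from SL(2,R) to PSL(2,R) is a two-fold covering, so a subgroup of PSL(2,R)
  is discrete iff its preimage is a discrete set of matrices.
\<close>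

definition fuchsian_group :: "(real^2^2) set set \<Rightarrow> bool" where
  "fuchsian_group \<Gamma> \<longleftrightarrow> subgroup \<Gamma> PSL2R \<and> discrete (\<Union>\<Gamma>)"

definition hyp_orbit :: "(real^2^2) set set \<Rightarrow> complex \<Rightarrow> complex set" where
  "hyp_orbit \<Gamma> z = (\<lambda>A. moebius A z) ` \<Union>\<Gamma>"

text \<open>
  Accumulation in the Riemann sphere: an orbit accumulates at infinity iff it is unbounded.
\<close>

fun limit_point_of_orbit :: "(real^2^2) set set \<Rightarrow> complex \<Rightarrow> boundary_point \<Rightarrow> bool" where
  "limit_point_of_orbit \<Gamma> z (Finite_Point x) \<longleftrightarrow> of_real x islimpt hyp_orbit \<Gamma> z"
| "limit_point_of_orbit \<Gamma> z Infinity_Point \<longleftrightarrow> \<not> bounded (hyp_orbit \<Gamma> z)"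

definition fuchsian_first_kind :: "(real^2^2) set set \<Rightarrow> bool" where
  "fuchsian_first_kind \<Gamma> \<longleftrightarrow>
     fuchsian_group \<Gamma> \<and> (\<forall>p. \<exists>z\<in>upper_half_plane. limit_point_of_orbit \<Gamma> z p)"

definition hyp_area :: "complex measure" where
  "hyp_area = density lborel (\<lambda>z. indicator upper_half_plane z * ennreal (1 / (Im z)\<^sup>2))"

definition fundamental_domain :: "(real^2^2) set set \<Rightarrow> complex set \<Rightarrow> bool" where
  "fundamental_domain \<Gamma> F \<longleftrightarrow>
     F \<in> sets borel \<and> F \<subseteq> upper_half_plane \<and>
     (\<Union>A\<in>\<Union>\<Gamma>. moebius A ` F) = upper_half_plane \<and>
     (\<forall>A\<in>\<Union>\<Gamma>. A \<noteq> mat 1 \<longrightarrow> A \<noteq> - mat 1 \<longrightarrow> F \<inter> moebius A ` F \<in> null_sets hyp_area)"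

definition finite_covolume :: "(real^2^2) set set \<Rightarrow> bool" where
  "finite_covolume \<Gamma> \<longleftrightarrow> (\<exists>F. fundamental_domain \<Gamma> F \<and> emeasure hyp_area F < \<infinity>)"


section \<open>Cusps\<close>

definition parabolic :: "real^2^2 \<Rightarrow> bool" where
  "parabolic A \<longleftrightarrow> det A = 1 \<and> A \<noteq> mat 1 \<and> A \<noteq> - mat 1 \<and> \<bar>trace A\<bar> = 2"

definition is_cusp :: "(real^2^2) set set \<Rightarrow> boundary_point \<Rightarrow> bool" where
  "is_cusp \<Gamma> p \<longleftrightarrow> (\<exists>A\<in>\<Union>\<Gamma>. parabolic A \<and> moebius_boundary A p = p)"

definition boundary_orbit :: "(real^2^2) set set \<Rightarrow> boundary_point \<Rightarrow> boundary_point set" where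
  "boundary_orbit \<Gamma> p = (\<lambda>A. moebius_boundary A p) ` \<Union>\<Gamma>"

definition cusp_classes :: "(real^2^2) set set \<Rightarrow> boundary_point set set" where
  "cusp_classes \<Gamma> = boundary_orbit \<Gamma> ` {p. is_cusp \<Gamma> p}"

definition stabilizer :: "(real^2^2) set set \<Rightarrow> boundary_point \<Rightarrow> (real^2^2) set" where
  "stabilizer \<Gamma> p = {A \<in> \<Union>\<Gamma>. moebius_boundary A p = p}"

definition translation_matrix :: "real \<Rightarrow> real^2^2" where
  "translation_matrix t = vector [vector [1, t], vector [0, 1]]"

definition scaling_matrix :: "(real^2^2) set set \<Rightarrow> boundary_point \<Rightarrow> real^2^2 \<Rightarrow> bool" where
  "scaling_matrix \<Gamma> p S \<longleftrightarrow>
     det S = 1 \<and> moebius_boundary S Infinity_Point = p \<and>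
     (\<lambda>A. matrix_inv S ** A ** S) ` stabilizer \<Gamma> p =
       {B. \<exists>m::int. B = translation_matrix (of_int m) \<or> B = - translation_matrix (of_int m)}"

text \<open>
  A family of scaling matrices \<open>\<sigma>\<close>, one for each member of a complete set of inequivalent
  cusps; the cusps themselves are \<open>\<sigma> j \<infinity>\<close>.
\<close>

definition cusp_scaling :: "(real^2^2) set set \<Rightarrow> ('c::finite \<Rightarrow> real^2^2) \<Rightarrow> bool" where
  "cusp_scaling \<Gamma> \<sigma> \<longleftrightarrow>
     (\<forall>j. is_cusp \<Gamma> (moebius_boundary (\<sigma> j) Infinity_Point) \<and>
          scaling_matrix \<Gamma> (moebius_boundary (\<sigma> j) Infinity_Point) (\<sigma> j)) \<and>
     bij_betw (\<lambda>j. boundary_orbit \<Gamma> (moebius_boundary (\<sigma> j) Infinity_Point)) UNIV (cusp_classes \<Gamma>)"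


section \<open>Eisenstein series and the scattering determinant\<close>

definition stabilizer_cosets :: "(real^2^2) set set \<Rightarrow> boundary_point \<Rightarrow> (real^2^2) set set" where
  "stabilizer_cosets \<Gamma> p = (\<lambda>A. (\<lambda>B. B ** A) ` stabilizer \<Gamma> p) ` \<Union>\<Gamma>"

text \<open>
  The sum of \<open>Im (S\<inverse> \<gamma> z) ^ s\<close> over \<open>\<Gamma>\<^sub>p \<setminus> \<Gamma>\<close>, where \<open>S\<close> is a scaling matrix for the cusp
  \<open>p = S \<infinity>\<close>; the summand does not depend on the representative chosen in a coset.
\<close>

definition eisenstein :: "(real^2^2) set set \<Rightarrow> real^2^2 \<Rightarrow> complex \<Rightarrow> complex \<Rightarrow> complex" where
  "eisenstein \<Gamma> S z s =
     (\<Sum>\<^sub>\<infinity>C\<in>stabilizer_cosets \<Gamma> (moebius_boundary S Infinity_Point).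
        of_real (Im (moebius (matrix_inv S ** (SOME A. A \<in> C)) z)) powr s)"

text \<open>
  The constant term, as a function of \<open>y\<close>, of the Fourier expansion at the cusp \<open>T \<infinity>\<close>
  of the Eisenstein series attached to the cusp \<open>S \<infinity>\<close>.
\<close>

definition eisenstein_constant_term ::
    "(real^2^2) set set \<Rightarrow> real^2^2 \<Rightarrow> real^2^2 \<Rightarrow> complex \<Rightarrow> real \<Rightarrow> complex" where
  "eisenstein_constant_term \<Gamma> S T s y =
     integral {0..1} (\<lambda>x. eisenstein \<Gamma> S (moebius T (Complex x y)) s)"

text \<open>For \<open>Re s > 1\<close>, the range in which the Eisenstein series converge.\<close>

definition scattering_matrix ::
    "(real^2^2) set set \<Rightarrow> ('c::finite \<Rightarrow> real^2^2) \<Rightarrow> complex \<Rightarrow> complex^'c^'c" where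
  "scattering_matrix \<Gamma> \<sigma> s =
     (\<chi> j k. THE a. \<forall>y>0. eisenstein_constant_term \<Gamma> (\<sigma> j) (\<sigma> k) s y =
        (if j = k then of_real y powr s else 0) + a * of_real y powr (1 - s))"

text \<open>
  The scattering determinant is the meromorphic continuation to the complex plane of
  \<open>det (scattering_matrix \<Gamma> \<sigma> s)\<close>. With \<open>nicely_meromorphic_on\<close> removable singularities
  are removed, so that values such as \<open>\<phi> (1/2)\<close> are the intended ones, and \<open>\<phi>\<close> is uniquely
  determined; the value at a pole is 0 by convention.
\<close>

definition scattering_determinant ::
    "(real^2^2) set set \<Rightarrow> ('c::finite \<Rightarrow> real^2^2) \<Rightarrow> (complex \<Rightarrow> complex) \<Rightarrow> bool" where
  "scattering_determinant \<Gamma> \<sigma> \<phi> \<longleftrightarrow>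
     \<phi> nicely_meromorphic_on UNIV \<and>
     (\<forall>s. Re s > 1 \<longrightarrow> \<phi> s = det (scattering_matrix \<Gamma> \<sigma> s))"


section \<open>Zeros and poles on the half-line from 1/2 to infinity\<close>

definition real_zeros :: "(complex \<Rightarrow> complex) \<Rightarrow> real set" where
  "real_zeros f = {x. x \<ge> 1/2 \<and> \<not> is_pole f (of_real x) \<and> f (of_real x) = 0}"

definition real_poles :: "(complex \<Rightarrow> complex) \<Rightarrow> real set" where
  "real_poles f = {x. x \<ge> 1/2 \<and> is_pole f (of_real x)}"

definition num_real_zeros :: "(complex \<Rightarrow> complex) \<Rightarrow> nat" where
  "num_real_zeros f = (\<Sum>x\<in>real_zeros f. nat (zorder f (of_real x)))"

definition num_real_poles :: "(complex \<Rightarrow> complex) \<Rightarrow> nat" where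
  "num_real_poles f = (\<Sum>x\<in>real_poles f. nat (- zorder f (of_real x)))"

end

theory Submission
  imports Defs
begin

text \<open>
  The functional equation rules out a pole at \<open>1/2\<close> and forces \<open>\<phi> (1/2) = \<plusminus>1\<close>. By the
  Dirichlet series and the identity theorem applied to \<open>\<phi> s\<close> and \<open>cnj (\<phi> (cnj s))\<close>, \<open>\<phi>\<close> is real
  on the real axis, and for large real \<open>s\<close> its sign is that of the leading coefficient \<open>d 1\<close>. Moving
  from there down to \<open>1/2\<close>, the sign flips once for each zero and each pole, counted with multiplicity.
\<close>

section \<open>Meromorphic functions that are real on the real axis\<close>

lemma filterlim_of_real_at: "filterlim complex_of_real (at (of_real x)) (at x)"
  by (rule filterlim_atI) (auto intro!: tendsto_intros simp: eventually_at_filter)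

lemma eventually_at_of_real:
  assumes "eventually P (at (complex_of_real x))"
  shows "eventually (\<lambda>t. P (complex_of_real t)) (at x)"
  using assms filterlim_of_real_at by (rule eventually_compose_filterlim)

text \<open>Conjugation maps punctured discs around \<open>z\<close> to punctured discs around
  \<open>cnj z\<close>, and conjugating on both sides keeps holomorphy, so the singularity stays
  isolated. Poles and finite limits carry over because \<open>cnj w\<close> tends to
  \<open>cnj z\<close>.\<close>

lemma meromorphic_on_cnj_cnj:
  assumes "f meromorphic_on cnj ` A"
  shows "(\<lambda>z. cnj (f (cnj z))) meromorphic_on A"
proof (subst meromorphic_on_meromorphic_at, intro ballI)
  fix z assume "z \<in> A"
  then have "f meromorphic_on {cnj z}"
    by (intro meromorphic_on_subset[OF assms]) auto
  then have iso: "isolated_singularity_at f (cnj z)" and ess: "not_essential f (cnj z)"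
    by (auto simp: meromorphic_at_iff)
  have lim: "filterlim cnj (at (cnj z)) (at z)"
    by (rule filterlim_atI) (auto intro!: tendsto_intros simp: eventually_at_filter)
  obtain r where r: "r > 0" "f analytic_on ball (cnj z) r - {cnj z}"
    using iso by (auto simp: isolated_singularity_at_def)
  have "cnj ` (ball z r - {z}) = ball (cnj z) r - {cnj z}"
  proof (intro equalityI subsetI)
    fix w assume "w \<in> ball (cnj z) r - {cnj z}"
    then have "cnj w \<in> ball z r - {z}"
      by (auto simp: dist_norm) (metis complex_cnj_cnj complex_cnj_diff complex_mod_cnj)
    then show "w \<in> cnj ` (ball z r - {z})"
      by (metis complex_cnj_cnj imageI)
  next
    fix w assume "w \<in> cnj ` (ball z r - {z})"
    then show "w \<in> ball (cnj z) r - {cnj z}"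
      by (auto simp: dist_norm) (metis complex_cnj_diff complex_mod_cnj)
  qed
  then have "f holomorphic_on cnj ` (ball z r - {z})"
    using r(2) by (simp add: analytic_imp_holomorphic)
  then have "(\<lambda>z. cnj (f (cnj z))) holomorphic_on ball z r - {z}"
    using holomorphic_on_compose_cnj_cnj[of f "ball z r - {z}"] by (auto simp: o_def open_delete)
  then have "isolated_singularity_at (\<lambda>z. cnj (f (cnj z))) z"
    using r(1) by (intro isolated_singularity_at_holomorphic[of _ "ball z r"]) auto
  moreover have "not_essential (\<lambda>z. cnj (f (cnj z))) z"
  proof (cases "is_pole f (cnj z)")
    case True
    then have "filterlim (\<lambda>w. f (cnj w)) at_infinity (at z)"
      unfolding is_pole_def using lim by (rule filterlim_compose)
    then have "is_pole (\<lambda>z. cnj (f (cnj z))) z"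
      unfolding is_pole_def by (subst (asm) filterlim_at_infinity_conv_norm_at_top,
        subst filterlim_at_infinity_conv_norm_at_top) simp
    then show ?thesis by (simp add: not_essential_def)
  next
    case False
    then obtain c where "(f \<longlongrightarrow> c) (at (cnj z))"
      using ess by (auto simp: not_essential_def)
    then have "((\<lambda>w. f (cnj w)) \<longlongrightarrow> c) (at z)"
      using lim by (rule filterlim_compose)
    then have "((\<lambda>w. cnj (f (cnj w))) \<longlongrightarrow> cnj c) (at z)"
      by (intro tendsto_intros)
    then show ?thesis by (auto simp: not_essential_def)
  qed
  ultimately show "(\<lambda>z. cnj (f (cnj z))) meromorphic_on {z}"
    by (simp add: meromorphic_at_iff)
qed

text \<open>At a real point, \<open>f\<close> is real exactly when \<open>D\<close>, the difference
  of \<open>f\<close> and its conjugate reflection, vanishes. A meromorphic function on the plane is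
  zero off a sparse set or nonzero off a sparse set, so real values accumulating at one
  \<open>x0\<close> force reality near every \<open>x\<close>.\<close>

lemma meromorphic_real_on_real_axis:
  assumes mero: "f meromorphic_on UNIV"
    and freq: "frequently (\<lambda>t. f (complex_of_real t) \<in> \<real>) (at x0)"
  shows "eventually (\<lambda>t. f (complex_of_real t) \<in> \<real>) (at x)"
proof -
  define D where "D = (\<lambda>z. f z - cnj (f (cnj z)))"
  have D_real: "D (complex_of_real t) = 0 \<longleftrightarrow> f (complex_of_real t) \<in> \<real>" for t
    by (auto simp: D_def Reals_cnj_iff)
  have "(\<lambda>z. cnj (f (cnj z))) meromorphic_on UNIV"
    using mero by (intro meromorphic_on_cnj_cnj) (rule meromorphic_on_subset, auto)
  then have "D meromorphic_on UNIV"
    unfolding D_def using mero by (intro meromorphic_intros)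
  then have "eventually (\<lambda>z. D z = 0) (cosparse UNIV) \<or> eventually (\<lambda>z. D z \<noteq> 0) (cosparse UNIV)"
    by (rule meromorphic_imp_constant_or_avoid) auto
  moreover have "\<not> eventually (\<lambda>z. D z \<noteq> 0) (cosparse UNIV)"
  proof
    assume "eventually (\<lambda>z. D z \<noteq> 0) (cosparse UNIV)"
    then have "eventually (\<lambda>t. D (complex_of_real t) \<noteq> 0) (at x0)"
      by (intro eventually_at_of_real eventually_cosparse_imp_eventually_at[of _ UNIV]) auto
    with freq show False
      by (simp add: D_real frequently_def)
  qed
  ultimately have "eventually (\<lambda>z. D z = 0) (cosparse UNIV)"
    by blast
  then have "eventually (\<lambda>t. D (complex_of_real t) = 0) (at x)"
    by (intro eventually_at_of_real eventually_cosparse_imp_eventually_at[of _ UNIV]) auto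
  then show ?thesis
    by (simp add: D_real)
qed

section \<open>Orders of zeros and poles, and signs along a real segment\<close>

lemma zorder_linear_factor:
  "zorder (\<lambda>w::complex. w - z) x = (if x = z then 1 else 0)"
proof (cases "x = z")
  case True
  have "zorder (\<lambda>w::complex. w - z) z = 1"
    by (rule zorder_eqI[where S = UNIV and g = "\<lambda>_. 1"]) auto
  with True show ?thesis by simp
next
  case False
  then show ?thesis
    by (auto intro!: zorder_eqI[where S = UNIV and g = "\<lambda>w. w - z"] holomorphic_intros)
qed

text \<open>Order 0 excludes both a pole and an isolated zero, so the limit at \<open>z\<close> is
  finite and nonzero. The conclusion concerns \<open>remove_sings f\<close> because the value
  \<open>f z\<close> itself need not be this limit.\<close>

lemma remove_sings_zorder_0:
  assumes "f meromorphic_on {z}" and "eventually (\<lambda>w. f w \<noteq> 0) (at z)" and "zorder f z = 0"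
  shows "f \<midarrow>z\<rightarrow> remove_sings f z" "remove_sings f z \<noteq> 0" "isCont (remove_sings f) z"
proof -
  have iso: "isolated_singularity_at f z" and ess: "not_essential f z"
    using assms(1) by (auto simp: meromorphic_at_iff)
  have "\<not> is_pole f z"
    using isolated_pole_imp_neg_zorder[OF iso] assms(3) by auto
  then obtain c where c: "f \<midarrow>z\<rightarrow> c"
    using ess by (auto simp: not_essential_def)
  then have rc: "remove_sings f z = c" by auto
  then show "f \<midarrow>z\<rightarrow> remove_sings f z"
    using c by simp
  have "\<not> isolated_zero f z"
    using zorder_isolated_zero_pos'[of f z] assms iso by fastforce
  then show "remove_sings f z \<noteq> 0"
    using c rc assms(2) by (auto simp: isolated_zero_def)
  show "isCont (remove_sings f) z"
    using remove_sings_analytic_at[OF iso c] by (rule analytic_at_imp_isCont)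
qed

text \<open>
  Dividing \<open>f\<close> by the monomials \<open>(w - x) ^ zorder f x\<close> leaves a real, continuous and
  zero-free function on the segment, so the sign of \<open>f\<close> changes only with these monomials.
\<close>

lemma meromorphic_sign_between:
  fixes f :: "complex \<Rightarrow> complex" and a b :: real
  assumes mero: "f meromorphic_on UNIV" and "a \<le> b"
    and real: "\<And>x. x \<in> {a..b} \<Longrightarrow> eventually (\<lambda>t. f (complex_of_real t) \<in> \<real>) (at x)"
    and nz: "\<And>x. x \<in> {a..b} \<Longrightarrow> eventually (\<lambda>w. f w \<noteq> 0) (at (complex_of_real x))"
    and Z: "finite Z" "Z \<subseteq> {a<..<b}"
    and zorder_Z: "\<And>x. x \<in> {a..b} - Z \<Longrightarrow> zorder f (complex_of_real x) = 0"
    and ends: "isCont f (complex_of_real a)" "isCont f (complex_of_real b)"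
  shows "sgn (Re (f (complex_of_real a))) =
    (-1) ^ (\<Sum>x\<in>Z. nat \<bar>zorder f (complex_of_real x)\<bar>) * sgn (Re (f (complex_of_real b)))"
proof -
  define n where "n x = zorder f (complex_of_real x)" for x
  define P where "P w = (\<Prod>x\<in>Z. (w - complex_of_real x) powi (- n x))" for w
  define H where "H w = f w * P w" for w
  \<comment> \<open>At a point of \<open>Z\<close>, \<open>P\<close> contains a power of 0, whose
    default value (0 for every nonzero exponent) says nothing about the limit of \<open>H\<close>.
    Removing singularities puts the limit there.\<close>
  define h where "h = remove_sings H"
  have P_mero: "P meromorphic_on A" for A
    unfolding P_def by (intro meromorphic_intros analytic_on_imp_meromorphic_on analytic_intros)
  then have H_mero: "H meromorphic_on A" for A
    unfolding H_def using meromorphic_on_subset[OF mero] by (intro meromorphic_intros) auto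
  have P_nz: "P w \<noteq> 0" if "w \<notin> of_real ` Z" for w
    using that Z by (auto simp: P_def)
  have P_ev: "eventually (\<lambda>w. P w \<noteq> 0) (at z)" for z
  proof -
    have "eventually (\<lambda>w. w \<notin> of_real ` Z) (at z)"
      using islimpt_finite[OF finite_imageI[OF Z(1)], of z of_real]
      by (simp add: islimpt_conv_frequently_at frequently_def)
    then show ?thesis by eventually_elim (rule P_nz)
  qed
  have H_ev: "eventually (\<lambda>w. H w \<noteq> 0) (at (complex_of_real x))" if "x \<in> {a..b}" for x
    using nz[OF that] P_ev by eventually_elim (simp add: H_def)
  have zorder_P: "zorder P (complex_of_real x) = (if x \<in> Z then - n x else 0)" for x
  proof -
    have "zorder P (complex_of_real x) =
        (\<Sum>y\<in>Z. zorder (\<lambda>w. (w - complex_of_real y) powi (- n y)) (complex_of_real x))"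
      unfolding P_def using P_ev[unfolded P_def]
      by (intro zorder_prod) (auto intro!: meromorphic_intros)
    also have "\<dots> = (\<Sum>y\<in>Z. - n y * zorder (\<lambda>w. w - complex_of_real y) (complex_of_real x))"
    proof (intro sum.cong refl zorder_power_int)
      fix y
      have "eventually (\<lambda>w. w - complex_of_real y \<noteq> 0) (at (complex_of_real x))"
        using eventually_neq_at_within[of "complex_of_real y"] by simp
      then show "frequently (\<lambda>w. w - complex_of_real y \<noteq> 0) (at (complex_of_real x))"
        by (intro eventually_frequently) auto
    qed (intro meromorphic_intros)
    also have "\<dots> = (\<Sum>y\<in>Z. if y = x then - n y else 0)"
      by (intro sum.cong) (auto simp: zorder_linear_factor)
    also have "\<dots> = (if x \<in> Z then - n x else 0)"
      using Z(1) by simp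
    finally show ?thesis .
  qed
  have zorder_H: "zorder H (complex_of_real x) = 0" if x: "x \<in> {a..b}" for x
  proof -
    have "zorder H (complex_of_real x) = zorder f (complex_of_real x) + zorder P (complex_of_real x)"
      unfolding H_def using nz[OF x] P_ev
      by (intro zorder_mult P_mero meromorphic_on_subset[OF mero] eventually_frequently) auto
    also have "\<dots> = 0"
      using zorder_Z[of x] x by (auto simp: zorder_P n_def)
    finally show ?thesis .
  qed
  have h: "H \<midarrow>of_real x\<rightarrow> h (of_real x)" "h (of_real x) \<noteq> 0" "isCont h (of_real x)"
    if "x \<in> {a..b}" for x
    using remove_sings_zorder_0[OF H_mero H_ev zorder_H, OF that that] by (auto simp: h_def)
  have P_real: "P (complex_of_real t) = of_real (\<Prod>x\<in>Z. (t - x) powi (- n x))" for t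
    by (simp add: P_def)
  have h_real: "h (of_real x) \<in> \<real>" if x: "x \<in> {a..b}" for x
  proof -
    \<comment> \<open>The value of \<open>h\<close> is approached along the real line, where
      \<open>H\<close> is real, and the reals are closed.\<close>
    have "((\<lambda>t. H (complex_of_real t)) \<longlongrightarrow> h (of_real x)) (at x)"
      using h(1)[OF x] filterlim_of_real_at by (rule filterlim_compose)
    moreover have "eventually (\<lambda>t. H (complex_of_real t) \<in> \<real>) (at x)"
      using real[OF x] by eventually_elim (simp add: H_def P_real del: of_real_prod)
    ultimately show ?thesis
      using Lim_in_closed_set[OF closed_complex_Reals] by (metis trivial_limit_at)
  qed
  have h_same_sign: "sgn (Re (h (of_real a))) = sgn (Re (h (of_real b)))"
  proof -
    have cont: "continuous_on {a..b} (\<lambda>t. Re (h (of_real t)))"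
    proof (intro continuous_at_imp_continuous_on ballI)
      fix x assume "x \<in> {a..b}"
      then have "isCont (\<lambda>t. h (complex_of_real t)) x"
        using isCont_o2[of x complex_of_real h] h(3) by (simp add: continuous_of_real)
      then show "isCont (\<lambda>t. Re (h (of_real t))) x"
        by (rule continuous_Re)
    qed
    have nz': "Re (h (of_real x)) \<noteq> 0" if "x \<in> {a..b}" for x
      using h(2)[OF that] h_real[OF that] by (auto simp: complex_is_Real_iff complex_eq_iff)
    show ?thesis
    proof (rule ccontr)
      assume "\<not> ?thesis"
      with nz'[of a] nz'[of b] \<open>a \<le> b\<close>
      consider "Re (h (of_real a)) \<le> 0" "0 \<le> Re (h (of_real b))"
        | "Re (h (of_real b)) \<le> 0" "0 \<le> Re (h (of_real a))"
        by (auto simp: sgn_if split: if_splits)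
      then obtain x where "x \<in> {a..b}" "Re (h (of_real x)) = 0"
        using IVT'[OF _ _ \<open>a \<le> b\<close> cont] IVT2'[OF _ _ \<open>a \<le> b\<close> cont] by (metis atLeastAtMost_iff)
      with nz' show False by blast
    qed
  qed
  \<comment> \<open>Off \<open>Z\<close> the monomials are invertible, so \<open>f\<close> is
    recovered from \<open>h\<close>. Continuity of \<open>f\<close> at \<open>x\<close> identifies
    the actual value of \<open>H\<close> with its limit \<open>h\<close>.\<close>
  have f_end: "sgn (Re (f (of_real x))) = sgn (\<Prod>y\<in>Z. (x - y) powi n y) * sgn (Re (h (of_real x)))"
    if x: "x \<in> {a..b}" "x \<notin> Z" "isCont f (complex_of_real x)" for x
  proof -
    have "isCont P (complex_of_real x)"
      unfolding P_def using x(2) by (intro continuous_intros) auto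
    then have "isCont H (complex_of_real x)"
      unfolding H_def using x(3) by (intro continuous_intros)
    then have "H (of_real x) = h (of_real x)"
      using h(1)[OF x(1)] LIM_unique by (auto simp: isCont_def)
    then have "h (of_real x) = f (of_real x) * of_real (\<Prod>y\<in>Z. (x - y) powi (- n y))"
      by (simp add: H_def P_real)
    then have "Re (h (of_real x)) = Re (f (of_real x)) * (\<Prod>y\<in>Z. (x - y) powi (- n y))"
      by (simp del: of_real_prod)
    moreover have "(\<Prod>y\<in>Z. (x - y) powi (- n y)) * (\<Prod>y\<in>Z. (x - y) powi n y) = 1"
      using x(2) by (subst prod.distrib[symmetric])
        (auto intro!: prod.neutral left_inverse simp: power_int_minus)
    ultimately have "Re (f (of_real x)) = (\<Prod>y\<in>Z. (x - y) powi n y) * Re (h (of_real x))"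
      by algebra
    then show ?thesis
      by (simp add: sgn_mult)
  qed
  have ab: "a \<in> {a..b}" "a \<notin> Z" "b \<in> {a..b}" "b \<notin> Z"
    using \<open>a \<le> b\<close> Z by auto
  \<comment> \<open>\<open>Z\<close> lies strictly between \<open>a\<close> and \<open>b\<close>:
    every \<open>b - y\<close> is positive and every \<open>a - y\<close> negative, so only the left
    end picks up signs.\<close>
  have "(\<Prod>y\<in>Z. (b - y) powi n y) > 0"
    using Z by (intro prod_pos) (auto intro!: zero_less_power_int)
  then have b: "sgn (Re (f (of_real b))) = sgn (Re (h (of_real b)))"
    using f_end[OF ab(3,4) ends(2)] by simp
  have "sgn (\<Prod>y\<in>Z. (a - y) powi n y) = (\<Prod>y\<in>Z. sgn ((a - y) powi n y))"
    by (induction Z rule: infinite_finite_induct) (auto simp: sgn_mult)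
  also have "\<dots> = (\<Prod>y\<in>Z. (-1) ^ nat \<bar>n y\<bar>)"
  proof (intro prod.cong refl)
    fix y assume "y \<in> Z"
    then have "a - y < 0" using Z by auto
    then have "sgn ((a - y) ^ k) = (-1) ^ k" for k
      by (induction k) (auto simp: sgn_mult)
    \<comment> \<open>A negative exponent inverts the base, which keeps its sign, so only the parity
      of \<open>n y\<close> counts: zeros and poles flip the sign alike.\<close>
    then show "sgn ((a - y) powi n y) = (-1) ^ nat \<bar>n y\<bar>"
      by (auto simp: power_int_def simp flip: power_inverse)
  qed
  also have "\<dots> = (-1) ^ (\<Sum>y\<in>Z. nat \<bar>n y\<bar>)"
    by (simp add: power_sum)
  finally show ?thesis
    using f_end[OF ab(1,2) ends(1)] b h_same_sign by (simp add: n_def)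
qed

section \<open>The sign of a generalized Dirichlet series\<close>

text \<open>Multiplied by \<open>g 1 powr t\<close>, the series becomes \<open>d 1\<close> plus a
  tail bounded by a constant times \<open>(g 1 / g 2) powr t\<close>. Once the tail is smaller than
  the absolute value of \<open>d 1\<close>, it cannot change the sign.\<close>

lemma generalized_dirichlet_series_sgn:
  fixes d g :: "nat \<Rightarrow> real"
  assumes "0 < g 1" and mono: "strict_mono_on {1..} g" and "d 1 \<noteq> 0"
    and summable: "\<And>t. t \<ge> t0 \<Longrightarrow> (\<lambda>n. \<bar>d n / g n powr t\<bar>) summable_on {1..}"
  shows "eventually (\<lambda>t. sgn (\<Sum>\<^sub>\<infinity>n\<in>{1..}. d n / g n powr t) = sgn (d 1)) at_top"
proof -
  define K where "K = (\<Sum>\<^sub>\<infinity>n\<in>{2..}. \<bar>d n / g n powr t0\<bar>)"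
  define q where "q = g 1 / g 2"
  have g12: "g 1 < g 2"
    using mono by (auto simp: strict_mono_on_def)
  then have q: "0 < q" "q < 1"
    using \<open>0 < g 1\<close> by (auto simp: q_def)
  have g2n: "g 2 \<le> g n" if "n \<ge> 2" for n
    using strict_mono_on_leD[OF mono, of 2 n] that by auto
  have sum2: "(\<lambda>n. \<bar>d n / g n powr t\<bar>) summable_on {2..}" if "t \<ge> t0" for t
    using that by (intro summable_on_subset_banach[OF summable]) auto
  have bound: "\<bar>g 1 powr t * (\<Sum>\<^sub>\<infinity>n\<in>{1..}. d n / g n powr t) - d 1\<bar>
      \<le> g 1 powr t0 * K * q powr (t - t0)" if t: "t \<ge> t0" for t
  proof -
    define T where "T = (\<Sum>\<^sub>\<infinity>n\<in>{2..}. d n / g n powr t)"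
    have "{1..} = insert 1 {2::nat..}" by auto
    moreover have "(\<lambda>n. d n / g n powr t) summable_on {2..}"
      using sum2[OF t] by (subst summable_on_iff_abs_summable_on_real) simp
    ultimately have split: "(\<Sum>\<^sub>\<infinity>n\<in>{1..}. d n / g n powr t) = d 1 / g 1 powr t + T"
      by (simp add: infsum_insert T_def)
    have "\<bar>T\<bar> \<le> (\<Sum>\<^sub>\<infinity>n\<in>{2..}. \<bar>d n / g n powr t\<bar>)"
      unfolding T_def using norm_infsum_bound[of "\<lambda>n. d n / g n powr t" "{2..}"] sum2[OF t] by simp
    \<comment> \<open>Lowering the exponent from \<open>t\<close> to \<open>t0\<close> releases the
      factor \<open>1 / g n powr (t - t0)\<close>, which over \<open>n \<ge> 2\<close> is largest at
      \<open>n = 2\<close> because \<open>g\<close> increases. What remains sums to the fixed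
      constant \<open>K\<close>.\<close>
    also have "\<dots> \<le> (\<Sum>\<^sub>\<infinity>n\<in>{2..}. (1 / g 2 powr (t - t0)) * \<bar>d n / g n powr t0\<bar>)"
    proof (rule infsum_mono[OF sum2[OF t] summable_on_cmult_right[OF sum2[OF order.refl]]])
      fix n :: nat assume "n \<in> {2..}"
      then have g: "g 2 \<le> g n" "0 < g 2" "0 < g n"
        using g2n[of n] g12 \<open>0 < g 1\<close> by auto
      have "\<bar>d n / g n powr t\<bar> = (1 / g n powr (t - t0)) * \<bar>d n / g n powr t0\<bar>"
        using g by (simp add: powr_diff)
      also have "\<dots> \<le> (1 / g 2 powr (t - t0)) * \<bar>d n / g n powr t0\<bar>"
        using g t by (intro mult_right_mono divide_left_mono powr_mono2) auto
      finally show "\<bar>d n / g n powr t\<bar> \<le> (1 / g 2 powr (t - t0)) * \<bar>d n / g n powr t0\<bar>" .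
    qed
    also have "\<dots> = K / g 2 powr (t - t0)"
      by (subst infsum_cmult_right') (simp add: K_def)
    finally have T: "\<bar>T\<bar> \<le> K / g 2 powr (t - t0)" .
    have "\<bar>g 1 powr t * (\<Sum>\<^sub>\<infinity>n\<in>{1..}. d n / g n powr t) - d 1\<bar> = g 1 powr t * \<bar>T\<bar>"
      using \<open>0 < g 1\<close> unfolding split by (simp add: distrib_left abs_mult)
    also have "\<dots> \<le> g 1 powr t * (K / g 2 powr (t - t0))"
      using T by (intro mult_left_mono) auto
    also have "\<dots> = g 1 powr t0 * K * q powr (t - t0)"
      using \<open>0 < g 1\<close> g12 by (simp add: q_def powr_divide powr_diff)
    finally show ?thesis .
  qed
  have "((\<lambda>t. exp ((t - t0) * ln q)) \<longlongrightarrow> 0) at_top"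
  proof (rule filterlim_compose[OF exp_at_bot])
    have "filterlim (\<lambda>t. - t0 + t) at_top at_top"
      by (rule filterlim_tendsto_add_at_top[OF tendsto_const filterlim_ident])
    then have "filterlim (\<lambda>t. ln q * (t - t0)) at_bot at_top"
      using q by (intro filterlim_tendsto_neg_mult_at_bot[OF tendsto_const]) auto
    then show "filterlim (\<lambda>t. (t - t0) * ln q) at_bot at_top"
      by (simp add: mult.commute)
  qed
  then have "((\<lambda>t. g 1 powr t0 * K * q powr (t - t0)) \<longlongrightarrow> g 1 powr t0 * K * 0) at_top"
    using q by (intro tendsto_intros) (simp add: powr_def)
  then have "eventually (\<lambda>t. g 1 powr t0 * K * q powr (t - t0) < \<bar>d 1\<bar>) at_top"
    using \<open>d 1 \<noteq> 0\<close> by (intro order_tendstoD(2)) auto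
  then show ?thesis
    using eventually_ge_at_top[of t0]
  proof eventually_elim
    case (elim t)
    define S where "S = (\<Sum>\<^sub>\<infinity>n\<in>{1..}. d n / g n powr t)"
    have "\<bar>g 1 powr t * S - d 1\<bar> < \<bar>d 1\<bar>"
      using bound[of t] elim by (simp add: S_def)
    then have "sgn (g 1 powr t * S) = sgn (d 1)"
      by (auto simp: sgn_if abs_if split: if_splits)
    then show ?case
      using \<open>0 < g 1\<close> by (simp add: sgn_mult S_def)
  qed
qed

section \<open>The scattering determinant on the half-line from 1/2 to infinity\<close>

theorem theorem1p1:
  fixes \<Gamma> :: "(real^2^2) set set"
    and \<sigma> :: "'c::finite \<Rightarrow> real^2^2"
    and \<phi> :: "complex \<Rightarrow> complex"
    and c :: nat
    and g d :: "nat \<Rightarrow> real"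
  assumes "fuchsian_first_kind \<Gamma>" and "finite_covolume \<Gamma>"
    and "c = card (cusp_classes \<Gamma>)" and "c > 0"
    and "cusp_scaling \<Gamma> \<sigma>"
    and "scattering_determinant \<Gamma> \<sigma> \<phi>"
    and functional_equation:
      "\<And>s. \<not> is_pole \<phi> s \<Longrightarrow> \<not> is_pole \<phi> (1 - s) \<Longrightarrow> \<phi> s * \<phi> (1 - s) = 1"
    and "0 < g 1" and "strict_mono_on {1..} g"
    and "d 1 \<noteq> 0"
    and summable: "\<And>s. Re s > 1 \<Longrightarrow>
      (\<lambda>n. norm (complex_of_real (d n) / complex_of_real (g n) powr (2 * s))) summable_on {1..}"
    and series: "\<And>s. Re s > 1 \<Longrightarrow>
      \<phi> s = of_real (pi powr (real c / 2)) * (Gamma (s - 1/2) / Gamma s) ^ c *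
        (\<Sum>\<^sub>\<infinity>n\<in>{1..}. of_real (d n) / of_real (g n) powr (2 * s))"
  shows "finite (real_zeros \<phi>) \<and> finite (real_poles \<phi>) \<and>
    \<phi> (1/2) = (-1) ^ (num_real_zeros \<phi> + num_real_poles \<phi>) * of_real (sgn (d 1))"
proof -
  have nicely: "\<phi> nicely_meromorphic_on UNIV"
    using assms(6) by (simp add: scattering_determinant_def)
  then have mero: "\<phi> meromorphic_on A" for A
    using meromorphic_on_subset unfolding nicely_meromorphic_on_def by blast
  have g_pos: "0 < g n" if "n \<in> {1..}" for n
    using strict_mono_on_leD[OF \<open>strict_mono_on {1..} g\<close>, of 1 n] that \<open>0 < g 1\<close> by auto
  \<comment> \<open>\<open>C\<close> is the prefactor at a real argument, positive for
    \<open>t > 1\<close> since both Gamma values are then positive. \<open>S\<close> takes the full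
    exponent \<open>u = 2 * s\<close>.\<close>
  define C where "C t = pi powr (real c / 2) * (Gamma (t - 1/2) / Gamma t) ^ c" for t :: real
  define S where "S u = (\<Sum>\<^sub>\<infinity>n\<in>{1..}. d n / g n powr u)" for u
  have C_pos: "C t > 0" if "t > 1" for t
    using that by (simp add: C_def)
  have summand: "complex_of_real (d n) / complex_of_real (g n) powr (2 * complex_of_real t) =
      of_real (d n / g n powr (2 * t))" if "n \<in> {1..}" for n t
    using powr_of_real[of "g n" "2 * t"] g_pos[OF that] by simp
  have summable_real: "(\<lambda>n. \<bar>d n / g n powr u\<bar>) summable_on {1..}" if "u > 2" for u
  proof -
    have "(\<lambda>n. norm (complex_of_real (d n) / complex_of_real (g n) powr (2 * complex_of_real (u / 2))))
        summable_on {1..}"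
      using that by (intro summable) simp
    also have "?this \<longleftrightarrow> (\<lambda>n. \<bar>d n / g n powr u\<bar>) summable_on {1..}"
      by (intro summable_on_cong, subst summand) (simp_all del: of_real_divide)
    finally show ?thesis .
  qed
  have \<phi>_real: "\<phi> (of_real t) = of_real (C t * S (2 * t))" if "t > 1" for t
  proof -
    have "(\<lambda>n. d n / g n powr (2 * t)) summable_on {1..}"
      using summable_real[of "2 * t"] that by (subst summable_on_iff_abs_summable_on_real) simp
    then have "((\<lambda>n. complex_of_real (d n / g n powr (2 * t))) has_sum of_real (S (2 * t))) {1..}"
      unfolding S_def by (intro has_sum_of_real has_sum_infsum)
    then have "(\<Sum>\<^sub>\<infinity>n\<in>{1..}. complex_of_real (d n) / of_real (g n) powr (2 * of_real t)) =
        of_real (S (2 * t))"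
      by (subst infsum_cong[OF summand]) (auto intro: infsumI)
    moreover have "Gamma (complex_of_real t - 1/2) = of_real (Gamma (t - 1/2))"
      using Gamma_complex_of_real[of "t - 1/2"] by simp
    ultimately show ?thesis
      using series[of "of_real t"] that by (simp add: C_def Gamma_complex_of_real)
  qed
  \<comment> \<open>The series converges absolutely for exponents \<open>u > 2\<close>, that is for
    \<open>Re s > 1\<close>; 3 is a convenient starting point in this range.\<close>
  have "eventually (\<lambda>u. sgn (S u) = sgn (d 1)) at_top"
    unfolding S_def using assms(8-10) summable_real
    by (intro generalized_dirichlet_series_sgn[where ?t0.0 = 3]) auto
  then have "eventually (\<lambda>t. sgn (S (2 * t)) = sgn (d 1)) at_top"
    by (rule eventually_compose_filterlim)
      (rule filterlim_tendsto_pos_mult_at_top[OF tendsto_const _ filterlim_ident], simp)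
  then obtain b0 where b0: "\<And>t. t \<ge> b0 \<Longrightarrow> sgn (S (2 * t)) = sgn (d 1)"
    by (auto simp: eventually_at_top_linorder)
  \<comment> \<open>The maximum with 2 keeps \<open>t\<close> in the range \<open>t > 1\<close>
    where the series represents \<open>\<phi>\<close>.\<close>
  define b where "b = max b0 2"
  have sgn_b: "sgn (Re (\<phi> (of_real t))) = sgn (d 1)" and nz_b: "\<phi> (of_real t) \<noteq> 0"
    if "t \<ge> b" for t
  proof -
    have t: "t > 1" "t \<ge> b0" using that by (auto simp: b_def)
    show "sgn (Re (\<phi> (of_real t))) = sgn (d 1)"
      using \<phi>_real[OF t(1)] b0[OF t(2)] C_pos[OF t(1)] by (simp add: sgn_mult)
    then show "\<phi> (of_real t) \<noteq> 0"
      using \<open>d 1 \<noteq> 0\<close> by (auto simp: sgn_zero_iff)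
  qed
  \<comment> \<open>The point 2 is an arbitrary choice: near any real point above 1 the series
    supplies the accumulating real values.\<close>
  have "eventually (\<lambda>t. t \<in> {1<..}) (at (2::real))"
    by (intro eventually_at_in_open') auto
  then have "eventually (\<lambda>t. \<phi> (complex_of_real t) \<in> \<real>) (at 2)"
    by eventually_elim (simp add: \<phi>_real)
  then have real: "eventually (\<lambda>t. \<phi> (complex_of_real t) \<in> \<real>) (at x)" for x
    by (rule meromorphic_real_on_real_axis[OF mero eventually_frequently[OF at_neq_bot]])
  have nz_cosparse: "eventually (\<lambda>w. \<phi> w \<noteq> 0) (cosparse UNIV)"
  proof -
    have "\<not> eventually (\<lambda>w. \<phi> w = 0) (cosparse UNIV)"
    proof
      assume "eventually (\<lambda>w. \<phi> w = 0) (cosparse UNIV)"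
      \<comment> \<open>The point \<open>b + 1\<close> has a whole real neighbourhood to the right
        of \<open>b\<close>, where \<open>\<phi>\<close> does not vanish.\<close>
      then have "eventually (\<lambda>t. \<phi> (complex_of_real t) = 0) (at (b + 1))"
        by (intro eventually_at_of_real eventually_cosparse_imp_eventually_at[of _ UNIV]) auto
      moreover have "eventually (\<lambda>t. t \<in> {b<..}) (at (b + 1))"
        by (intro eventually_at_in_open') auto
      ultimately have "eventually (\<lambda>t. False) (at (b + 1))"
        by eventually_elim (use nz_b in fastforce)
      then show False by simp
    qed
    then show ?thesis
      using meromorphic_imp_constant_or_avoid[OF mero, of UNIV 0] by auto
  qed
  have nz: "eventually (\<lambda>w. \<phi> w \<noteq> 0) (at z)" for z
    using nz_cosparse by (rule eventually_cosparse_imp_eventually_at) auto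
  have no_pole_half: "\<not> is_pole \<phi> (1/2)"
  proof
    assume pole: "is_pole \<phi> (1/2)"
    \<comment> \<open>The reflection \<open>1 - w\<close> fixes 1/2, so a pole there would send both
      factors of \<open>\<phi> w * \<phi> (1 - w)\<close> to infinity. Poles are isolated, so the
      functional equation holds at all nearby \<open>w\<close> and keeps the product at 1.\<close>
    have refl_lim: "filterlim (\<lambda>w::complex. 1 - w) (at (1/2)) (at (1/2))"
      by (rule filterlim_atI) (auto intro!: tendsto_eq_intros simp: eventually_at_filter field_simps)
    have no_pole: "eventually (\<lambda>w. \<not> is_pole \<phi> w) (at (1/2))"
      using meromorphic_on_imp_not_pole_cosparse[OF mero[of UNIV]]
      by (rule eventually_cosparse_imp_eventually_at) auto
    have "eventually (\<lambda>w. \<phi> w * \<phi> (1 - w) = 1) (at (1/2))"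
      using no_pole eventually_compose_filterlim[OF no_pole refl_lim]
      by eventually_elim (rule functional_equation)
    then have "((\<lambda>w. \<phi> w * \<phi> (1 - w)) \<longlongrightarrow> 1) (at (1/2))"
      by (rule tendsto_eventually)
    moreover have "filterlim (\<lambda>w. \<phi> w * \<phi> (1 - w)) at_infinity (at (1/2))"
      using pole filterlim_compose[OF pole[unfolded is_pole_def] refl_lim]
      by (intro filterlim_at_infinity_times) (auto simp: is_pole_def)
    ultimately show False
      by (meson at_neq_bot not_tendsto_and_filterlim_at_infinity)
  qed
  then have "\<phi> (1/2) * \<phi> (1/2) = 1"
    using functional_equation[of "1/2"] by simp
  then have half: "\<phi> (1/2) = 1 \<or> \<phi> (1/2) = -1"
    by (simp add: square_eq_1_iff)
  define Z where "Z = real_zeros \<phi> \<union> real_poles \<phi>"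
  \<comment> \<open>A nicely meromorphic function takes the value 0 at its poles, so zeros and poles
    together are the points where \<open>\<phi>\<close> evaluates to 0.\<close>
  have Z_eq: "Z = {x. x \<ge> 1/2 \<and> \<phi> (of_real x) = 0}"
    using is_pole_zero_at_nicely_mero[OF nicely]
    by (auto simp: Z_def real_zeros_def real_poles_def)
  have Z_sub: "Z \<subseteq> {1/2<..<b}"
  proof
    fix x assume "x \<in> Z"
    then have x: "x \<ge> 1/2" "\<phi> (of_real x) = 0" by (auto simp: Z_eq)
    have "\<phi> (of_real (1/2)) \<noteq> 0"
      using half by auto
    with x(2) have "x \<noteq> 1/2"
      by blast
    moreover have "x < b"
      using nz_b[of x] x(2) by force
    ultimately show "x \<in> {1/2<..<b}"
      using x(1) by simp
  qed
  \<comment> \<open>The points where \<open>\<phi>\<close> evaluates to 0 form a sparse set, which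
    meets a compact segment in finitely many points.\<close>
  have "finite Z"
  proof -
    let ?K = "complex_of_real ` {1/2..b}"
    have "{w. \<phi> w = 0} sparse_in UNIV"
      using nz_cosparse by (simp add: eventually_cosparse)
    then have "{w. \<phi> w = 0} sparse_in ?K"
      by (rule sparse_in_subset) simp
    moreover have "compact ?K"
      by (intro compact_continuous_image continuous_intros) auto
    ultimately have "finite (?K \<inter> {w. \<phi> w = 0})"
      by (intro sparse_in_compact_finite)
    moreover have "complex_of_real ` Z \<subseteq> ?K \<inter> {w. \<phi> w = 0}"
      using Z_sub by (auto simp: Z_eq)
    ultimately have "finite (complex_of_real ` Z)"
      by (rule finite_subset[rotated])
    then show ?thesis
      by (rule finite_imageD) (auto simp: inj_on_def)
  qed
  have cont: "isCont \<phi> z" if "\<not> is_pole \<phi> z" for z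
    using nicely_meromorphic_on_imp_analytic_at[OF nicely _ that] by (simp add: analytic_at_imp_isCont)
  have zorder_0: "zorder \<phi> (of_real x) = 0" if "x \<in> {1/2..b} - Z" for x
  proof (rule not_pole_not_isolated_zero_imp_zorder_eq_0[OF mero])
    have "\<phi> (of_real x) \<noteq> 0" using that by (auto simp: Z_eq)
    then show "\<not> is_pole \<phi> (of_real x)" "\<not> isolated_zero \<phi> (of_real x)"
      using is_pole_zero_at_nicely_mero[OF nicely] zero_isolated_zero_nicely_meromorphic
        nicely_meromorphic_on_subset[OF nicely] by blast+
    show "frequently (\<lambda>w. \<phi> w \<noteq> 0) (at (of_real x))"
      using nz by (intro eventually_frequently) auto
  qed
  have sgn_half: "sgn (Re (\<phi> (of_real (1/2)))) =
      (-1) ^ (\<Sum>x\<in>Z. nat \<bar>zorder \<phi> (of_real x)\<bar>) * sgn (Re (\<phi> (of_real b)))"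
  proof (rule meromorphic_sign_between[OF mero _ real nz \<open>finite Z\<close> Z_sub zorder_0])
    show "isCont \<phi> (of_real (1/2))"
      using cont no_pole_half by simp
    show "isCont \<phi> (of_real b)"
      using cont nz_b[of b] is_pole_zero_at_nicely_mero[OF nicely] by blast
  qed (auto simp: b_def)
  \<comment> \<open>Orders are nonnegative at zeros and negative at poles, so their absolute values
    are exactly the multiplicities counted in \<open>num_real_zeros\<close> and
    \<open>num_real_poles\<close>.\<close>
  have zorder_sum: "(\<Sum>x\<in>Z. nat \<bar>zorder \<phi> (of_real x)\<bar>) = num_real_zeros \<phi> + num_real_poles \<phi>"
  proof -
    have "zorder \<phi> (of_real x) \<ge> 0" if "x \<in> real_zeros \<phi>" for x
      using zorder_neg_imp_is_pole[OF mero nz] that by (force simp: real_zeros_def)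
    then have zeros: "(\<Sum>x\<in>real_zeros \<phi>. nat \<bar>zorder \<phi> (of_real x)\<bar>) = num_real_zeros \<phi>"
      unfolding num_real_zeros_def by (intro sum.cong) auto
    have "zorder \<phi> (of_real x) < 0" if "x \<in> real_poles \<phi>" for x
      using isolated_pole_imp_neg_zorder mero[of "{of_real x}"] that
      by (auto simp: real_poles_def meromorphic_at_iff)
    then have poles: "(\<Sum>x\<in>real_poles \<phi>. nat \<bar>zorder \<phi> (of_real x)\<bar>) = num_real_poles \<phi>"
      unfolding num_real_poles_def by (intro sum.cong) (auto simp: abs_of_neg)
    have "real_zeros \<phi> \<inter> real_poles \<phi> = {}"
      by (auto simp: real_zeros_def real_poles_def)
    then show ?thesis
      using \<open>finite Z\<close> by (simp add: Z_def sum.union_disjoint zeros poles)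
  qed
  \<comment> \<open>Being 1 or -1, the value at 1/2 equals its own sign.\<close>
  have "\<phi> (1/2) = of_real (sgn (Re (\<phi> (of_real (1/2)))))"
    using half by auto
  also have "\<dots> = (-1) ^ (num_real_zeros \<phi> + num_real_poles \<phi>) * of_real (sgn (d 1))"
    by (simp only: sgn_half zorder_sum sgn_b order.refl) simp
  finally show ?thesis
    using \<open>finite Z\<close> by (simp add: Z_def)
qed

end
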